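(* There exist two different, isomorphic statistical structures $\langle K_{12},L_{12},\mu_{12}\rangle$ and $\langle \widetilde K_{12},\widetilde L_{12},\widetilde\mu_{12}\rangle$, both realizable over a Hilbert space, such that $$K(\mathbb C^2)\otimes K(\mathbb C^2)\subset K_{12},\ \widetilde K_{12}\subset B(\mathbb C^2)\otimes B(\mathbb C^2),$$ $$L(\mathbb C^2)\otimes L(\mathbb C^2)\subset L_{12},\ \widetilde L_{12}\subset B(\mathbb C^2)\otimes B(\mathbb C^2),$$ and $\mu_{12}(W,F)=\mathrm{Tr}(WF)$ for all $W\in K_{12},F\in L_{12}$, and $\widetilde\mu_{12}(\widetilde W,\widetilde F)=\mathrm{Tr}(\widetilde W\widetilde F)$ for all $\widetilde W\in\widetilde K_{12},\widetilde F\in\widetilde L_{12}$.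
   Context: For a complex Hilbert space $\mathcal H$ (finite-dimensional here), $B(\mathcal H)$ is the real vector space of Hermitian operators on $\mathcal H$; $K(\mathcal H)$ is the set of statistical operators (positive semi-definite, trace $1$); $L(\mathcal H)$ is the set of Hermitian operators with all eigenvalues in $[0,1]$. A statistical structure is a triple $\langle K,L,\mu\rangle$ of sets $K$, $L$ and a map $\mu:K\times L\to[0,1]$. It is realizable over a Hilbert space (the paper's Axiom 1) if there exist a complex separable Hilbert space $\mathcal H$ and bijections $f:K\to K(\mathcal H)$, $g:L\to L(\mathcal H)$ with $\mu(W,F)=\mathrm{Tr}(f(W)g(F))$ for all $W\in K$, $F\in L$. Two statistical structures $\langle K,L,\mu\rangle$, $\langle K',L',\mu'\rangle$ are isomorphic if there are bijections $K\to K'$, $L\to L'$ carrying $\mu$ to $\mu'$. $B(\mathbb C^2)\otimes B(\mathbb C^2)$ is identified with the space of Hermitian $4\times4$ matrices (Kronecker product). For subsets $S_1,S_2\subset B(\mathbb C^2)$, $S_1\otimes S_2$ denotes the set of product operators $\{X_1\otimes X_2: X_1\in S_1,X_2\in S_2\}$. *)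

theory Defs
  imports "Jordan_Normal_Form.Schur_Decomposition" "HOL-Library.FuncSet"
begin

definition mat_trace :: "'a :: comm_monoid_add mat \<Rightarrow> 'a" where
  "mat_trace A = (\<Sum>i<dim_row A. A $$ (i, i))"

(* B(C^n) *)
definition hermitian_ops :: "nat \<Rightarrow> complex mat set" where
  "hermitian_ops n = {A \<in> carrier_mat n n. mat_adjoint A = A}"

(* The order on complex numbers is that of Complex_Order: 0 \<le> z says that z is real and
   nonnegative. *)
definition psd_ops :: "nat \<Rightarrow> complex mat set" where
  "psd_ops n = {A \<in> hermitian_ops n. \<forall>v \<in> carrier_vec n. 0 \<le> (A *\<^sub>v v) \<bullet>c v}"

(* K(C^n) *)
definition statistical_ops :: "nat \<Rightarrow> complex mat set" where
  "statistical_ops n = {W \<in> psd_ops n. mat_trace W = 1}"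

(* L(C^n) *)
definition effect_ops :: "nat \<Rightarrow> complex mat set" where
  "effect_ops n = {F \<in> hermitian_ops n. \<forall>e. eigenvalue F e \<longrightarrow> 0 \<le> e \<and> e \<le> 1}"

definition kronecker :: "'a :: semiring_0 mat \<Rightarrow> 'a mat \<Rightarrow> 'a mat" where
  "kronecker A B = mat (dim_row A * dim_row B) (dim_col A * dim_col B)
     (\<lambda>(i, j). A $$ (i div dim_row B, j div dim_col B) * B $$ (i mod dim_row B, j mod dim_col B))"

definition product_ops :: "complex mat set \<Rightarrow> complex mat set \<Rightarrow> complex mat set" where
  "product_ops S1 S2 = {kronecker X1 X2 | X1 X2. X1 \<in> S1 \<and> X2 \<in> S2}"

(* In a triple (K, L, mu) the function mu is extensional on K \<times> L, so that equality of
   statistical structures is equality of triples and does not see values of mu outside K \<times> L. *)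
type_synonym ('k, 'l) stat_triple = "'k set \<times> 'l set \<times> ('k \<times> 'l \<Rightarrow> real)"

fun statistical_structure :: "('k, 'l) stat_triple \<Rightarrow> bool" where
  "statistical_structure (K, L, \<mu>) \<longleftrightarrow> \<mu> \<in> K \<times> L \<rightarrow>\<^sub>E {0..1}"

(* The finite-dimensional Hilbert spaces are taken to be the C^n; the dimension n is part of the
   existential claim. *)
fun realizable :: "('k, 'l) stat_triple \<Rightarrow> bool" where
  "realizable (K, L, \<mu>) \<longleftrightarrow>
     (\<exists>n f g. bij_betw f K (statistical_ops n) \<and> bij_betw g L (effect_ops n) \<and>
        (\<forall>W\<in>K. \<forall>F\<in>L. complex_of_real (\<mu> (W, F)) = mat_trace (f W * g F)))"

fun isomorphic_structures :: "('k, 'l) stat_triple \<Rightarrow> ('k2, 'l2) stat_triple \<Rightarrow> bool" where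
  "isomorphic_structures (K, L, \<mu>) (K', L', \<mu>') \<longleftrightarrow>
     (\<exists>\<phi> \<psi>. bij_betw \<phi> K K' \<and> bij_betw \<psi> L L' \<and>
        (\<forall>W\<in>K. \<forall>F\<in>L. \<mu>' (\<phi> W, \<psi> F) = \<mu> (W, F)))"

end

theory Submission
  imports Defs
begin

text \<open>The first structure is the usual one on \<open>\<complex>\<^sup>4\<close>; the second is its image under the partial
  transpose \<open>T(X\<^sub>1 \<otimes> X\<^sub>2) = X\<^sub>1 \<otimes> X\<^sub>2\<^sup>t\<close>. Since \<open>T\<close> is an involution with
  \<open>Tr(T(W) T(F)) = Tr(W F)\<close>, it is an isomorphism of the two structures, and it permutes product states
  and product effects because ordinary transposition preserves states and effects. The structures
  differ since the partial transpose of a maximally entangled state is not positive. That products of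
  effects are effects, and that \<open>Tr(W F)\<close> lies in \<open>[0, 1]\<close>, follows by writing positive matrices as sums
  of outer products \<open>v v\<^sup>*\<close>.\<close>

section \<open>Positive Hermitian matrices as sums of outer products\<close>

lemma mat_trace_mult:
  assumes "A \<in> carrier_mat n m" "B \<in> carrier_mat m n"
  shows "mat_trace (A * B) = (\<Sum>i<n. \<Sum>j<m. A $$ (i, j) * B $$ (j, i))"
  using assms by (auto simp: mat_trace_def scalar_prod_def lessThan_atLeast0 intro!: sum.cong)

lemma mat_trace_mult_comm:
  fixes A B :: "'a :: comm_semiring_0 mat"
  assumes "A \<in> carrier_mat n m" "B \<in> carrier_mat m n"
  shows "mat_trace (A * B) = mat_trace (B * A)"
  by (simp add: mat_trace_mult[OF assms] mat_trace_mult[OF assms(2,1)] mult.commute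
      sum.swap[of _ "{..<n}"])

lemma mat_trace_similar:
  fixes A :: "'a :: comm_semiring_1 mat"
  assumes "similar_mat_wit A B P Q"
  shows "mat_trace A = mat_trace B"
proof -
  note sim = similar_mat_witD[OF refl assms]
  have "mat_trace A = mat_trace (P * B * Q)"
    using sim(3) by (rule arg_cong)
  also have "\<dots> = mat_trace (Q * (P * B))"
    using sim(5-7) by (intro mat_trace_mult_comm) auto
  also have "Q * (P * B) = Q * P * B"
    using sim(5-7) by (intro assoc_mult_mat[symmetric]) auto
  finally show ?thesis
    using sim(2,5) by simp
qed

lemma mat_trace_add:
  assumes "A \<in> carrier_mat n n" "B \<in> carrier_mat n n"
  shows "mat_trace (A + B) = mat_trace A + mat_trace B"
  using assms by (auto simp: mat_trace_def sum.distrib)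

lemma mat_trace_minus:
  fixes A B :: "'a :: ab_group_add mat"
  assumes "A \<in> carrier_mat n n" "B \<in> carrier_mat n n"
  shows "mat_trace (A - B) = mat_trace A - mat_trace B"
  using assms by (auto simp: mat_trace_def sum_subtractf)

lemma hermitian_ops_iff:
  "A \<in> hermitian_ops n \<longleftrightarrow>
     A \<in> carrier_mat n n \<and> (\<forall>i<n. \<forall>j<n. cnj (A $$ (i, j)) = A $$ (j, i))"
proof (cases "A \<in> carrier_mat n n")
  case True
  then have "mat_adjoint A = mat n n (\<lambda>(i, j). cnj (A $$ (j, i)))"
    by (auto simp: mat_adjoint_def mat_of_rows_def)
  then have "mat_adjoint A = A \<longleftrightarrow> (\<forall>i<n. \<forall>j<n. cnj (A $$ (j, i)) = A $$ (i, j))"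
    using True by (simp only: mat_eq_iff) auto
  with True show ?thesis
    by (auto simp: hermitian_ops_def)
qed (auto simp: hermitian_ops_def)

lemma hermitian_ops_carrier: "A \<in> hermitian_ops n \<Longrightarrow> A \<in> carrier_mat n n"
  by (simp add: hermitian_ops_def)

lemma hermitian_ops_swap:
  assumes "A \<in> hermitian_ops n" "i < n" "j < n"
  shows "cnj (A $$ (i, j)) = A $$ (j, i)"
  using assms by (auto simp: hermitian_ops_iff)

lemma cnj_cscalar_prod:
  assumes "v \<in> carrier_vec n" "w \<in> carrier_vec n"
  shows "cnj (v \<bullet>c w) = w \<bullet>c v"
  using assms by (auto simp: scalar_prod_def mult.commute intro!: sum.cong)

lemma cscalar_prod_mult_mat_vec:
  assumes "A \<in> carrier_mat n n" "v \<in> carrier_vec n" "w \<in> carrier_vec n"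
  shows "(A *\<^sub>v v) \<bullet>c w = (\<Sum>i<n. \<Sum>j<n. A $$ (i, j) * v $ j * cnj (w $ i))"
  using assms by (auto simp: scalar_prod_def lessThan_atLeast0 sum_distrib_right intro!: sum.cong)

lemma hermitian_ops_self_adjoint:
  assumes A: "A \<in> hermitian_ops n" and v: "v \<in> carrier_vec n" and w: "w \<in> carrier_vec n"
  shows "(A *\<^sub>v v) \<bullet>c w = v \<bullet>c (A *\<^sub>v w)"
proof -
  have "v \<bullet>c (A *\<^sub>v w) = (\<Sum>i<n. \<Sum>j<n. v $ i * cnj (A $$ (i, j) * w $ j))"
    using hermitian_ops_carrier[OF A] v w
    by (auto simp: scalar_prod_def lessThan_atLeast0 sum_distrib_left intro!: sum.cong)
  also have "\<dots> = (\<Sum>j<n. \<Sum>i<n. v $ i * cnj (A $$ (i, j) * w $ j))"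
    by (rule sum.swap)
  also have "\<dots> = (\<Sum>i<n. \<Sum>j<n. A $$ (i, j) * v $ j * cnj (w $ i))"
    by (intro sum.cong) (auto simp: hermitian_ops_swap[OF A] mult_ac)
  finally show ?thesis
    using cscalar_prod_mult_mat_vec[OF hermitian_ops_carrier[OF A] v w] by simp
qed

lemma hermitian_ops_minus:
  assumes "A \<in> hermitian_ops n" "B \<in> hermitian_ops n"
  shows "A - B \<in> hermitian_ops n"
  using assms by (auto simp: hermitian_ops_iff)

lemma hermitian_ops_one: "1\<^sub>m n \<in> hermitian_ops n"
  by (auto simp: hermitian_ops_iff)

text \<open>Each term \<open>A $$ (i, j) * A $$ (j, i)\<close> is a squared modulus by Hermitian
  symmetry, so this is the squared Hilbert-Schmidt norm; its vanishing forces the matrix to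
  vanish.\<close>

lemma mat_trace_square_hermitian:
  assumes "A \<in> hermitian_ops n"
  shows "mat_trace (A * A) = of_real (\<Sum>i<n. \<Sum>j<n. (cmod (A $$ (i, j)))\<^sup>2)"
  using hermitian_ops_swap[OF assms]
  by (simp add: mat_trace_mult[OF hermitian_ops_carrier[OF assms] hermitian_ops_carrier[OF assms]]
      complex_norm_square del: of_real_power)

lemma hermitian_ops_trace_square_zero:
  assumes A: "A \<in> hermitian_ops n" and tr: "mat_trace (A * A) = 0"
  shows "A = 0\<^sub>m n n"
proof -
  have "(\<Sum>i<n. \<Sum>j<n. (cmod (A $$ (i, j)))\<^sup>2) = 0"
    using tr unfolding mat_trace_square_hermitian[OF A] of_real_eq_0_iff .
  then have "\<forall>i<n. \<forall>j<n. A $$ (i, j) = 0"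
    by (simp add: sum_nonneg_eq_0_iff sum_nonneg)
  with hermitian_ops_carrier[OF A] show ?thesis by auto
qed

text \<open>If all eigenvalues vanish, then \<open>A\<close> is similar to a strictly upper triangular matrix, so
  \<open>A\<^sup>2\<close> has trace zero; but for Hermitian \<open>A\<close> this trace is the sum of all squared moduli of
  entries.\<close>

lemma hermitian_ops_nonzero_eigenvalue:
  assumes A: "A \<in> hermitian_ops n" and nz: "A \<noteq> 0\<^sub>m n n"
  obtains e where "eigenvalue A e" "e \<noteq> 0"
proof (rule ccontr)
  assume "\<not> thesis"
  with that have no: "\<And>e. eigenvalue A e \<Longrightarrow> e = 0" by blast
  note cA = hermitian_ops_carrier[OF A]
  from char_poly_factorized[OF cA] obtain es where es: "char_poly A = (\<Prod>a\<leftarrow>es. [:- a, 1:])"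
    by auto
  have es0: "e = 0" if "e \<in> set es" for e
  proof -
    have "poly (char_poly A) e = 0"
      using that by (auto simp: es poly_prod_list prod_list_zero_iff)
    then have "eigenvalue A e"
      using eigenvalue_root_char_poly[OF cA] by simp
    with no show ?thesis by blast
  qed
  obtain B P Q where "schur_decomposition A es = (B, P, Q)"
    by (cases "schur_decomposition A es") auto
  from schur_decomposition[OF cA es this]
  have sim: "similar_mat_wit A B P Q" and ut: "upper_triangular B" and diag: "diag_mat B = es"
    by auto
  from similar_mat_witD2[OF cA sim] have cB: "B \<in> carrier_mat n n" by auto
  have "B $$ (i, i) = 0" if "i < n" for i
    using that cB by (intro es0) (auto simp: diag[symmetric] diag_mat_def)
  \<comment> \<open>Off the diagonal, one of the two entries lies below it and vanishes by
    triangularity; on the diagonal, both are entries of \<open>es\<close>, which are zero.\<close>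
  then have B0: "B $$ (i, j) * B $$ (j, i) = 0" if "i < n" "j < n" for i j
    using that cB upper_triangularD[OF ut, of i j] upper_triangularD[OF ut, of j i]
    by (cases i j rule: linorder_cases) auto
  have "similar_mat_wit (A ^\<^sub>m 2) (B ^\<^sub>m 2) P Q"
    by (rule similar_mat_wit_pow[OF sim])
  then have "mat_trace (A * A) = mat_trace (B * B)"
    using mat_trace_similar cA cB by (fastforce simp: numeral_2_eq_2)
  also have "\<dots> = 0"
    unfolding mat_trace_mult[OF cB cB] by (intro sum.neutral ballI) (simp add: B0 del: mult_eq_0_iff)
  finally show False
    using hermitian_ops_trace_square_zero[OF A] nz by blast
qed

section \<open>The cone generated by outer products, and its duality with positive quadratic
  forms\<close>

definition outer_prod :: "complex vec \<Rightarrow> complex mat" where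
  "outer_prod v = mat (dim_vec v) (dim_vec v) (\<lambda>(i, j). v $ i * cnj (v $ j))"

text \<open>Finite sums of outer products suffice: a nonnegative scalar is absorbed into the vector
  through its square root. The inductive form lets additive statements be proved one rank-one
  summand at a time.\<close>

inductive_set psd_cone :: "nat \<Rightarrow> complex mat set" for n where
  zero: "0\<^sub>m n n \<in> psd_cone n"
| add_outer: "A \<in> psd_cone n \<Longrightarrow> v \<in> carrier_vec n \<Longrightarrow> A + outer_prod v \<in> psd_cone n"

lemma outer_prod_carrier: "v \<in> carrier_vec n \<Longrightarrow> outer_prod v \<in> carrier_mat n n"
  by (auto simp: outer_prod_def)

lemma outer_prod_smult: "outer_prod (c \<cdot>\<^sub>v v) = (c * cnj c) \<cdot>\<^sub>m outer_prod v"
  by (auto simp: outer_prod_def)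

lemma outer_prod_hermitian: "v \<in> carrier_vec n \<Longrightarrow> outer_prod v \<in> hermitian_ops n"
  by (auto simp: hermitian_ops_iff outer_prod_def)

lemma outer_prod_mult_vec:
  assumes "v \<in> carrier_vec n" "w \<in> carrier_vec n"
  shows "outer_prod v *\<^sub>v w = (w \<bullet>c v) \<cdot>\<^sub>v v"
  using assms by (auto simp: outer_prod_def scalar_prod_def sum_distrib_right intro!: eq_vecI sum.cong)

text \<open>The bridge between the two notions of positivity: pairing with a rank-one operator under
  the trace evaluates the quadratic form.\<close>

lemma mat_trace_mult_outer_prod:
  assumes "A \<in> carrier_mat n n" "v \<in> carrier_vec n"
  shows "mat_trace (A * outer_prod v) = (A *\<^sub>v v) \<bullet>c v"
  unfolding mat_trace_mult[OF assms(1) outer_prod_carrier[OF assms(2)]]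
    cscalar_prod_mult_mat_vec[OF assms(1,2,2)]
  using assms(2) by (intro sum.cong) (auto simp: outer_prod_def)

lemma psd_cone_hermitian: "A \<in> psd_cone n \<Longrightarrow> A \<in> hermitian_ops n"
proof (induction rule: psd_cone.induct)
  case (add_outer A v)
  then show ?case using outer_prod_hermitian[of v n] by (auto simp: hermitian_ops_iff)
qed (auto simp: hermitian_ops_iff)

lemmas psd_cone_carrier = hermitian_ops_carrier[OF psd_cone_hermitian]

lemma psd_cone_add:
  assumes A: "A \<in> psd_cone n" and "B \<in> psd_cone n"
  shows "A + B \<in> psd_cone n"
  using assms(2)
proof (induction rule: psd_cone.induct)
  case zero
  then show ?case using A psd_cone_carrier[OF A] by simp
next
  case (add_outer B v)
  then have "A + (B + outer_prod v) = (A + B) + outer_prod v"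
    using psd_cone_carrier[OF A] psd_cone_carrier[of B n] outer_prod_carrier[of v n]
    by (metis assoc_add_mat)
  with add_outer show ?case by (simp add: psd_cone.add_outer)
qed

lemma outer_prod_psd_cone:
  assumes "v \<in> carrier_vec n"
  shows "outer_prod v \<in> psd_cone n"
  using psd_cone.add_outer[OF psd_cone.zero assms] outer_prod_carrier[OF assms] by simp

text \<open>The trace is additive in \<open>B\<close>, and each outer product contributes a value of
  the quadratic form of \<open>A\<close>.\<close>

lemma mat_trace_mult_nonneg:
  assumes A: "A \<in> psd_ops n" and B: "B \<in> psd_cone n"
  shows "0 \<le> mat_trace (A * B)"
  using B
proof (induction rule: psd_cone.induct)
  case zero
  then show ?case using A by (auto simp: psd_ops_def hermitian_ops_def mat_trace_def)
next
  case (add_outer B v)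
  have cA: "A \<in> carrier_mat n n" using A by (auto simp: psd_ops_def hermitian_ops_def)
  have "mat_trace (A * (B + outer_prod v)) = mat_trace (A * B) + mat_trace (A * outer_prod v)"
    using add_outer cA psd_cone_carrier[of B n] outer_prod_carrier[of v n]
    by (simp add: mult_add_distrib_mat[of A n n _ n] mat_trace_add[of _ n])
  also have "\<dots> \<ge> 0"
    using A add_outer mat_trace_mult_outer_prod[OF cA, of v]
    by (auto simp: psd_ops_def intro!: add_nonneg_nonneg)
  finally show ?case .
qed

text \<open>The form of \<open>A\<close> at \<open>w\<close> is the trace of
  \<open>outer_prod w * A\<close>, so \<open>mat_trace_mult_nonneg\<close> applies with the roles
  exchanged: \<open>outer_prod w\<close> has a nonnegative form, namely the squared modulus of
  \<open>v \<bullet>c w\<close>, and \<open>A\<close> is the cone element.\<close>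

lemma psd_cone_psd_ops:
  assumes "A \<in> psd_cone n"
  shows "A \<in> psd_ops n"
proof -
  have "0 \<le> (A *\<^sub>v w) \<bullet>c w" if w: "w \<in> carrier_vec n" for w
  proof -
    have *: "outer_prod w \<in> psd_ops n"
    proof -
      have "0 \<le> (outer_prod w *\<^sub>v v) \<bullet>c v" if v: "v \<in> carrier_vec n" for v
      proof -
        have "(outer_prod w *\<^sub>v v) \<bullet>c v = (v \<bullet>c w) * cnj (v \<bullet>c w)"
          using v w by (simp add: outer_prod_mult_vec cnj_cscalar_prod[of v n w])
        then show ?thesis using conjugate_square_positive[of "v \<bullet>c w"] by simp
      qed
      then show ?thesis using outer_prod_hermitian[OF w] by (auto simp: psd_ops_def)
    qed
    have "(A *\<^sub>v w) \<bullet>c w = mat_trace (outer_prod w * A)"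
      using mat_trace_mult_outer_prod[OF psd_cone_carrier[OF assms] w]
        mat_trace_mult_comm[OF psd_cone_carrier[OF assms] outer_prod_carrier[OF w]] by simp
    with mat_trace_mult_nonneg[OF * assms] show ?thesis by simp
  qed
  then show ?thesis using psd_cone_hermitian[OF assms] by (auto simp: psd_ops_def)
qed

section \<open>Positivity through eigenvalues, by successive removal of eigenvectors\<close>

lemma psd_ops_eigenvalue_nonneg:
  assumes A: "A \<in> psd_ops n" and e: "eigenvalue A e"
  shows "0 \<le> e"
proof -
  have cA: "A \<in> carrier_mat n n" using A by (auto simp: psd_ops_def hermitian_ops_def)
  from e cA obtain v where v: "v \<in> carrier_vec n" "v \<noteq> 0\<^sub>v n" and Av: "A *\<^sub>v v = e \<cdot>\<^sub>v v"
    by (auto simp: eigenvalue_def eigenvector_def)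
  have "0 \<le> e * (v \<bullet>c v)"
    using A v Av by (auto simp: psd_ops_def)
  moreover have "0 < v \<bullet>c v" using v by simp
  ultimately show ?thesis
    by (auto simp: less_eq_complex_def less_complex_def zero_le_mult_iff)
qed


text \<open>Induction on the number of missing basis vectors: an eigenvector \<open>v\<close> for a nonzero eigenvalue
  is orthogonal to the kernel, and subtracting the corresponding multiple of its outer product moves
  \<open>v\<close> into the kernel without creating new nonzero eigenvalues.\<close>

lemma hermitian_ops_nonneg_eigenvalues_psd_cone_aux:
  assumes "A \<in> hermitian_ops n" "\<And>e. eigenvalue A e \<Longrightarrow> 0 \<le> e"
    and "corthogonal vs" "set vs \<subseteq> carrier_vec n" "length vs + k = n"
    and "\<And>v. v \<in> set vs \<Longrightarrow> A *\<^sub>v v = 0\<^sub>v n"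
  shows "A \<in> psd_cone n"
  using assms
proof (induction k arbitrary: A vs)
  case 0
  note cA = hermitian_ops_carrier[OF 0(1)]
  \<comment> \<open>No basis vector is missing, so \<open>vs\<close> is an orthogonal basis inside
    the kernel of \<open>A\<close>. As columns it gives an invertible \<open>P\<close> with
    \<open>A * P = 0\<close>, whence \<open>A = 0\<close>.\<close>
  define P where "P = mat_of_cols n vs"
  have cP: "P \<in> carrier_mat n n" using 0(5) by (auto simp: P_def)
  have "corthogonal_mat P"
    unfolding P_def using 0 by (intro orthogonal_mat_of_cols) auto
  then have inv: "inverts_mat (corthogonal_inv P) P"
    by (rule corthogonal_inv_result)
  define Q where "Q = corthogonal_inv P"
  have cQ: "Q \<in> carrier_mat n n"
    using cP by (auto simp: Q_def corthogonal_inv_def)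
  have "Q * P = 1\<^sub>m n"
    using inv cQ unfolding Q_def inverts_mat_def by simp
  then have PQ: "P * Q = 1\<^sub>m n"
    using mat_mult_left_right_inverse[OF cQ cP] by simp
  have AP: "A * P = 0\<^sub>m n n"
  proof (rule mat_col_eqI)
    fix j assume "j < dim_col (0\<^sub>m n n :: complex mat)"
    then have j: "j < length vs" using 0 by simp
    then have "col P j = vs ! j"
      using 0(4) by (auto simp: P_def intro!: col_mat_of_cols)
    then have "A *\<^sub>v col P j = 0\<^sub>v n" using 0(6) j by auto
    moreover have "j < n" using j 0(5) by simp
    ultimately show "col (A * P) j = col (0\<^sub>m n n) j"
      using col_mult2[OF cA cP] by simp
  qed (use cA cP in auto)
  have "A = A * P * Q"
    using assoc_mult_mat[OF cA cP cQ] PQ cA by simp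
  then show ?case
    using AP cQ by (simp add: psd_cone.zero)
next
  case (Suc k)
  note cA = hermitian_ops_carrier[OF Suc.prems(1)]
  show ?case
  proof (cases "A = 0\<^sub>m n n")
    case True
    then show ?thesis by (simp add: psd_cone.zero)
  next
    case False
    then obtain e where e: "eigenvalue A e" "e \<noteq> 0"
      using hermitian_ops_nonzero_eigenvalue[OF Suc.prems(1)] by blast
    obtain v where v: "v \<in> carrier_vec n" "v \<noteq> 0\<^sub>v n" and Av: "A *\<^sub>v v = e \<cdot>\<^sub>v v"
      using e(1) cA by (auto simp: eigenvalue_def eigenvector_def)
    have zero0: "0 \<cdot>\<^sub>v v = 0\<^sub>v n" using v by auto
    have vv: "0 < v \<bullet>c v" using v by simp
    have "0 < e" using Suc.prems(2)[OF e(1)] e(2) by simp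
    \<comment> \<open>This is the factor for which \<open>c\<close> times the outer product of
      \<open>v\<close> sends \<open>v\<close> to \<open>e\<close> times \<open>v\<close>. It is real
      and positive, as are \<open>e\<close> and the squared norm of \<open>v\<close>, so with its
      real root \<open>s\<close> the multiple is the outer product of \<open>u\<close>.\<close>
    define c where "c = e / (v \<bullet>c v)"
    define s where "s = complex_of_real (sqrt (Re c))"
    have "0 < Re e / Re (v \<bullet>c v)" "e = of_real (Re e)" "v \<bullet>c v = of_real (Re (v \<bullet>c v))"
      using \<open>0 < e\<close> vv by (auto simp: less_complex_def complex_eq_iff)
    then have "0 < Re c" "c = of_real (Re c)"
      unfolding c_def by (metis Re_complex_of_real of_real_divide)+
    then have s: "s * cnj s = c"
      unfolding s_def by (metis complex_cnj_complex_of_real less_imp_le of_real_mult real_sqrt_mult_self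
          abs_of_nonneg)
    define u where "u = s \<cdot>\<^sub>v v"
    have u: "u \<in> carrier_vec n" using v by (simp add: u_def)
    define B where "B = A - outer_prod u"
    have Bw: "B *\<^sub>v w = A *\<^sub>v w - (c * (w \<bullet>c v)) \<cdot>\<^sub>v v" if "w \<in> carrier_vec n" for w
    proof -
      have "outer_prod u *\<^sub>v w = (s * cnj s * (w \<bullet>c v)) \<cdot>\<^sub>v v"
        using v that by (subst outer_prod_mult_vec[OF u that])
          (simp add: u_def conjugate_smult_vec smult_smult_assoc mult_ac)
      then show ?thesis
        unfolding B_def using cA outer_prod_carrier[OF u] that
        by (subst minus_mult_distrib_mat_vec[of _ n n]) (auto simp: s)
    qed
    have orth: "w \<bullet>c v = 0" if "w \<in> carrier_vec n" "A *\<^sub>v w = 0\<^sub>v n" for w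
    proof -
      have "e * (v \<bullet>c w) = (A *\<^sub>v v) \<bullet>c w"
        using v that by (simp add: Av)
      also have "\<dots> = 0"
        using v that by (simp add: hermitian_ops_self_adjoint[OF Suc.prems(1)])
      finally have "v \<bullet>c w = 0" using e by simp
      then show ?thesis using cnj_cscalar_prod[OF v(1) that(1)] by simp
    qed
    have BH: "B \<in> hermitian_ops n"
      unfolding B_def by (intro hermitian_ops_minus Suc.prems outer_prod_hermitian u)
    have Bv: "B *\<^sub>v v = 0\<^sub>v n"
      using vv v by (simp add: Bw Av c_def)
    have "B \<in> psd_cone n"
    proof (rule Suc.IH[of B "v # vs"])
      fix x assume "eigenvalue B x"
      then obtain w where w: "w \<in> carrier_vec n" "w \<noteq> 0\<^sub>v n" and Bx: "B *\<^sub>v w = x \<cdot>\<^sub>v w"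
        using hermitian_ops_carrier[OF BH] by (auto simp: eigenvalue_def eigenvector_def)
      show "0 \<le> x"
      proof (cases "x = 0")
        case False
        \<comment> \<open>Eigenvectors of the Hermitian \<open>B\<close> for nonzero
          \<open>x\<close> are orthogonal to \<open>v\<close>, which lies in the kernel of
          \<open>B\<close>. There the subtracted term vanishes, so \<open>x\<close> is already an
          eigenvalue of \<open>A\<close>.\<close>
        have "x * (w \<bullet>c v) = (B *\<^sub>v w) \<bullet>c v"
          using v w by (simp add: Bx)
        also have "\<dots> = 0"
          using v w by (simp add: hermitian_ops_self_adjoint[OF BH] Bv)
        finally have "w \<bullet>c v = 0" using False by simp
        then have "A *\<^sub>v w = x \<cdot>\<^sub>v w"
          using Bx Bw[OF w(1)] cA v w zero0 by simp
        then have "eigenvalue A x"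
          using w cA by (auto simp: eigenvalue_def eigenvector_def)
        then show ?thesis by (rule Suc.prems)
      qed simp
    next
      have "w \<bullet>c v = 0" "v \<bullet>c w = 0" if "w \<in> set vs" for w
        using orth[of w] that Suc.prems cnj_cscalar_prod[of w n v] v(1) by auto
      then show "corthogonal (v # vs)"
        using vv Suc.prems(3) by (auto simp: corthogonal_def nth_Cons' less_Suc_eq_0_disj)
    next
      fix w assume "w \<in> set (v # vs)"
      then show "B *\<^sub>v w = 0\<^sub>v n"
        using Bv Suc.prems(4,6) orth[of w] Bw[of w] zero0 by (cases "w = v") auto
    qed (use BH v Suc.prems in auto)
    moreover have "A = B + outer_prod u"
      unfolding B_def using cA outer_prod_carrier[OF u] by auto
    ultimately show ?thesis
      using psd_cone.add_outer[OF _ u] by metis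
  qed
qed

text \<open>The induction is started from the empty list, with all \<open>n\<close> kernel vectors
  still missing.\<close>

lemma hermitian_ops_nonneg_eigenvalues_psd_cone:
  assumes "A \<in> hermitian_ops n" "\<And>e. eigenvalue A e \<Longrightarrow> 0 \<le> e"
  shows "A \<in> psd_cone n"
  using hermitian_ops_nonneg_eigenvalues_psd_cone_aux[OF assms, of "[]" n]
  by (auto simp: corthogonal_def)

lemma psd_ops_eq_psd_cone: "psd_ops n = psd_cone n"
proof
  show "psd_ops n \<subseteq> psd_cone n"
  proof
    fix A assume A: "A \<in> psd_ops n"
    then have "A \<in> hermitian_ops n" by (simp add: psd_ops_def)
    then show "A \<in> psd_cone n"
      using psd_ops_eigenvalue_nonneg[OF A] by (rule hermitian_ops_nonneg_eigenvalues_psd_cone)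
  qed
qed (use psd_cone_psd_ops in blast)

section \<open>Effects as pairs of complementary positive operators\<close>

lemma eigenvalue_one_minus:
  assumes "A \<in> carrier_mat n n" "eigenvalue A e"
  shows "eigenvalue (1\<^sub>m n - A) (1 - e)"
proof -
  obtain v where v: "v \<in> carrier_vec n" "v \<noteq> 0\<^sub>v n" "A *\<^sub>v v = e \<cdot>\<^sub>v v"
    using assms by (auto simp: eigenvalue_def eigenvector_def)
  have "(1\<^sub>m n - A) *\<^sub>v v = (1 - e) \<cdot>\<^sub>v v"
    using assms v by (subst minus_mult_distrib_mat_vec[of _ n n]) (auto simp: algebra_simps)
  with v assms show ?thesis
    by (auto simp: eigenvalue_def eigenvector_def)
qed

text \<open>An upper bound 1 on the eigenvalues of \<open>F\<close> is a lower bound 0 on those of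
  its complement. This trades spectra, which are awkward for products and transposes, for two cone
  memberships.\<close>

lemma effect_ops_iff:
  "F \<in> effect_ops n \<longleftrightarrow> F \<in> psd_cone n \<and> 1\<^sub>m n - F \<in> psd_cone n"
proof
  assume F: "F \<in> effect_ops n"
  then have H: "F \<in> hermitian_ops n" by (simp add: effect_ops_def)
  note cF = hermitian_ops_carrier[OF H]
  have "F \<in> psd_cone n"
    using F H by (auto simp: effect_ops_def intro!: hermitian_ops_nonneg_eigenvalues_psd_cone)
  moreover have "1\<^sub>m n - F \<in> psd_cone n"
  proof (rule hermitian_ops_nonneg_eigenvalues_psd_cone)
    fix e assume "eigenvalue (1\<^sub>m n - F) e"
    then have "eigenvalue (1\<^sub>m n - (1\<^sub>m n - F)) (1 - e)"
      using cF by (intro eigenvalue_one_minus) auto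
    also have "1\<^sub>m n - (1\<^sub>m n - F) = F" using cF by auto
    finally show "0 \<le> e" using F by (auto simp: effect_ops_def)
  qed (intro hermitian_ops_minus hermitian_ops_one H)
  ultimately show "F \<in> psd_cone n \<and> 1\<^sub>m n - F \<in> psd_cone n" ..
next
  assume *: "F \<in> psd_cone n \<and> 1\<^sub>m n - F \<in> psd_cone n"
  have "0 \<le> e \<and> e \<le> 1" if "eigenvalue F e" for e
    using * psd_ops_eigenvalue_nonneg[of F n e] psd_ops_eigenvalue_nonneg[of "1\<^sub>m n - F" n "1 - e"]
      eigenvalue_one_minus[OF psd_cone_carrier that] that
    by (auto simp: psd_ops_eq_psd_cone)
  with * show "F \<in> effect_ops n"
    by (auto simp: effect_ops_def psd_cone_hermitian)
qed

section \<open>Kronecker products\<close>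

lemma div_mult_add_mod_less:
  fixes i j m n :: nat
  assumes "i < n * m" "j < n * m"
  shows "i div m * m + j mod m < n * m"
proof -
  have "m > 0" using assms by (cases m) auto
  then have "i div m * m + j mod m < (i div m + 1) * m" by simp
  also have "\<dots> \<le> n * m"
    using less_mult_imp_div_less[OF assms(1)] by (intro mult_le_mono1) simp
  finally show ?thesis .
qed

lemma mod_less_of_less_mult: "i < n * m \<Longrightarrow> i mod m < (m :: nat)"
  by (cases m) auto

text \<open>The numbering \<open>i * m + j\<close> of pairs is inverted by div and mod; it is the
  ordering of product basis vectors used by \<open>kronecker\<close>.\<close>

lemma sum_div_mod:
  fixes f :: "nat \<Rightarrow> nat \<Rightarrow> 'a :: comm_monoid_add"
  shows "(\<Sum>i<n * m. f (i div m) (i mod m)) = (\<Sum>i<n. \<Sum>j<m. f i j)"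
proof -
  have "(\<Sum>i<n * m. f (i div m) (i mod m)) = (\<Sum>(i, j)\<in>{..<n} \<times> {..<m}. f i j)"
  proof (rule sum.reindex_bij_witness[where i = "\<lambda>(i, j). i * m + j" and j = "\<lambda>i. (i div m, i mod m)"])
    fix p assume "p \<in> {..<n} \<times> {..<m}"
    then obtain i j where p: "p = (i, j)" "i < n" "j < m" by auto
    have "i * m + j < (i + 1) * m" using p by simp
    also have "\<dots> \<le> n * m" using p by (intro mult_le_mono1) simp
    finally show "(case p of (i, j) \<Rightarrow> i * m + j) \<in> {..<n * m}" by (simp add: p)
  qed (auto simp: less_mult_imp_div_less mod_less_of_less_mult)
  then show ?thesis by (simp add: sum.cartesian_product)
qed

lemma kronecker_carrier:
  "A \<in> carrier_mat n n' \<Longrightarrow> B \<in> carrier_mat m m' \<Longrightarrow> kronecker A B \<in> carrier_mat (n * m) (n' * m')"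
  by (auto simp: kronecker_def)

lemma kronecker_add_left:
  fixes A B :: "'a :: semiring_0 mat"
  assumes "A \<in> carrier_mat n n'" "B \<in> carrier_mat n n'"
  shows "kronecker (A + B) C = kronecker A C + kronecker B C"
  using assms by (auto simp: kronecker_def algebra_simps less_mult_imp_div_less intro!: eq_matI)

lemma kronecker_add_right:
  fixes A B :: "'a :: semiring_0 mat"
  assumes "A \<in> carrier_mat n n'" "B \<in> carrier_mat n n'"
  shows "kronecker C (A + B) = kronecker C A + kronecker C B"
  using assms by (auto simp: kronecker_def algebra_simps mod_less_of_less_mult intro!: eq_matI)

lemma kronecker_one: "kronecker (1\<^sub>m n) (1\<^sub>m m) = (1\<^sub>m (n * m) :: 'a :: semiring_1 mat)"
proof (rule eq_matI)
  fix i j assume "i < dim_row (1\<^sub>m (n * m) :: 'a mat)" "j < dim_col (1\<^sub>m (n * m) :: 'a mat)"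
  moreover have "i = j \<longleftrightarrow> i div m = j div m \<and> i mod m = j mod m"
    by (metis div_mult_mod_eq)
  ultimately show "kronecker (1\<^sub>m n) (1\<^sub>m m) $$ (i, j) = (1\<^sub>m (n * m) :: 'a mat) $$ (i, j)"
    by (auto simp: kronecker_def less_mult_imp_div_less mod_less_of_less_mult)
qed (auto simp: kronecker_def)

lemma mat_trace_kronecker:
  fixes A B :: "'a :: comm_semiring_0 mat"
  assumes "A \<in> carrier_mat n n" "B \<in> carrier_mat m m"
  shows "mat_trace (kronecker A B) = mat_trace A * mat_trace B"
  using assms sum_div_mod[of "\<lambda>i j. A $$ (i, i) * B $$ (j, j)" m n]
  by (simp add: mat_trace_def kronecker_def sum_product)

text \<open>The vector on the right is the tensor product of \<open>v\<close> and \<open>w\<close>,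
  so rank-one operators multiply to rank-one operators.\<close>

lemma kronecker_outer_prod:
  "kronecker (outer_prod v) (outer_prod w) =
     outer_prod (vec (dim_vec v * dim_vec w) (\<lambda>i. v $ (i div dim_vec w) * w $ (i mod dim_vec w)))"
  by (auto simp: kronecker_def outer_prod_def less_mult_imp_div_less mod_less_of_less_mult intro!: eq_matI)

text \<open>By additivity in each factor, two nested inductions reduce the claim to a product of two
  outer products.\<close>

lemma kronecker_psd_cone:
  assumes "A \<in> psd_cone n" "B \<in> psd_cone m"
  shows "kronecker A B \<in> psd_cone (n * m)"
  using assms(1)
proof (induction rule: psd_cone.induct)
  case zero
  have "kronecker (0\<^sub>m n n) B = 0\<^sub>m (n * m) (n * m)"
    using psd_cone_carrier[OF assms(2)] by (auto simp: kronecker_def less_mult_imp_div_less intro!: eq_matI)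
  then show ?case by (simp add: psd_cone.zero)
next
  case (add_outer A v)
  note cv = outer_prod_carrier[OF add_outer.hyps(2)]
  from assms(2) have "kronecker (outer_prod v) B \<in> psd_cone (n * m)"
  proof (induction rule: psd_cone.induct)
    case zero
    have "kronecker (outer_prod v) (0\<^sub>m m m) = 0\<^sub>m (n * m) (n * m)"
      using cv by (auto simp: kronecker_def mod_less_of_less_mult intro!: eq_matI)
    then show ?case by (simp add: psd_cone.zero)
  next
    case (add_outer B w)
    then show ?case
      using psd_cone_carrier[of B m] outer_prod_carrier[of w m] \<open>v \<in> carrier_vec n\<close>
      by (auto simp: kronecker_add_right[of _ m m] kronecker_outer_prod
          intro!: psd_cone_add outer_prod_psd_cone)
  qed
  with add_outer psd_cone_carrier[OF add_outer.hyps(1)] cv show ?case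
    by (auto simp: kronecker_add_left[of _ n n] intro!: psd_cone_add)
qed

lemma product_ops_statistical_ops:
  "product_ops (statistical_ops n) (statistical_ops m) \<subseteq> statistical_ops (n * m)"
  by (auto simp: product_ops_def statistical_ops_def psd_ops_eq_psd_cone kronecker_psd_cone
      mat_trace_kronecker[OF psd_cone_carrier psd_cone_carrier])

lemma one_psd_cone: "1\<^sub>m n \<in> psd_cone n"
  by (auto simp: psd_ops_def hermitian_ops_one simp flip: psd_ops_eq_psd_cone)

text \<open>The complement splits into positive products: \<open>1 - X \<otimes> Y = (1 - X)
  \<otimes> 1 + X \<otimes> (1 - Y)\<close>.\<close>

lemma product_ops_effect_ops:
  "product_ops (effect_ops n) (effect_ops m) \<subseteq> effect_ops (n * m)"
proof
  fix Z assume "Z \<in> product_ops (effect_ops n) (effect_ops m)"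
  then obtain X Y where Z: "Z = kronecker X Y"
    and X: "X \<in> psd_cone n" "1\<^sub>m n - X \<in> psd_cone n"
    and Y: "Y \<in> psd_cone m" "1\<^sub>m m - Y \<in> psd_cone m"
    by (auto simp: product_ops_def effect_ops_iff)
  note cX = psd_cone_carrier[OF X(1)] and cY = psd_cone_carrier[OF Y(1)]
  have "1\<^sub>m n = (1\<^sub>m n - X) + X" "1\<^sub>m m = (1\<^sub>m m - Y) + Y"
    using cX cY by auto
  then have "1\<^sub>m (n * m) = kronecker (1\<^sub>m n - X) (1\<^sub>m m) + kronecker X ((1\<^sub>m m - Y) + Y)"
    using kronecker_add_left[of "1\<^sub>m n - X" n n X "1\<^sub>m m"] cX by (metis kronecker_one minus_carrier_mat)
  also have "kronecker X ((1\<^sub>m m - Y) + Y) = kronecker X (1\<^sub>m m - Y) + kronecker X Y"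
    using cY by (intro kronecker_add_right[of _ m m]) auto
  finally have one: "1\<^sub>m (n * m) =
      kronecker (1\<^sub>m n - X) (1\<^sub>m m) + (kronecker X (1\<^sub>m m - Y) + kronecker X Y)" .
  have c: "kronecker (1\<^sub>m n - X) (1\<^sub>m m) \<in> carrier_mat (n * m) (n * m)"
    "kronecker X (1\<^sub>m m - Y) \<in> carrier_mat (n * m) (n * m)"
    "kronecker X Y \<in> carrier_mat (n * m) (n * m)"
    using cX cY by (auto intro!: kronecker_carrier)
  have "1\<^sub>m (n * m) - Z = kronecker (1\<^sub>m n - X) (1\<^sub>m m) + kronecker X (1\<^sub>m m - Y)"
    unfolding one Z using c by (intro eq_matI) auto
  with X Y show "Z \<in> effect_ops (n * m)"
    by (auto simp: effect_ops_iff Z kronecker_psd_cone one_psd_cone intro!: psd_cone_add)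
qed

section \<open>The partial transpose\<close>

text \<open>Transposing an outer product conjugates its vector and so yields another outer
  product.\<close>

lemma transpose_psd_cone: "A \<in> psd_cone n \<Longrightarrow> transpose_mat A \<in> psd_cone n"
proof (induction rule: psd_cone.induct)
  case zero
  show ?case by (simp add: psd_cone.zero)
next
  case (add_outer A v)
  have "transpose_mat (A + outer_prod v) = transpose_mat A + transpose_mat (outer_prod v)"
    using psd_cone_carrier[OF add_outer.hyps(1)] outer_prod_carrier[OF add_outer.hyps(2)]
    by (intro transpose_add)
  also have "transpose_mat (outer_prod v) = outer_prod (conjugate v)"
    by (auto simp: outer_prod_def mult.commute)
  finally show ?case
    using add_outer by (auto intro!: psd_cone.add_outer)
qed

lemma transpose_statistical_ops: "W \<in> statistical_ops n \<Longrightarrow> transpose_mat W \<in> statistical_ops n"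
  using psd_cone_carrier[of W n]
  by (auto simp: statistical_ops_def psd_ops_eq_psd_cone transpose_psd_cone mat_trace_def)

lemma transpose_effect_ops:
  assumes "F \<in> effect_ops n"
  shows "transpose_mat F \<in> effect_ops n"
proof -
  have c: "F \<in> carrier_mat n n" using assms psd_cone_carrier by (auto simp: effect_ops_iff)
  have "transpose_mat (1\<^sub>m n - F) = 1\<^sub>m n - transpose_mat F"
    using c by auto
  then show ?thesis
    using assms transpose_psd_cone[of F n] transpose_psd_cone[of "1\<^sub>m n - F" n]
    by (auto simp: effect_ops_iff)
qed

text \<open>An index \<open>i\<close> stands for the pair \<open>(i div m, i mod m)\<close>. Row and
  column keep their first components and exchange the second ones, which is transposition on the
  second tensor factor.\<close>

definition partial_transpose :: "nat \<Rightarrow> nat \<Rightarrow> 'a mat \<Rightarrow> 'a mat" where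
  "partial_transpose n m A =
     mat (n * m) (n * m) (\<lambda>(i, j). A $$ (i div m * m + j mod m, j div m * m + i mod m))"

lemma partial_transpose_carrier: "partial_transpose n m A \<in> carrier_mat (n * m) (n * m)"
  by (simp add: partial_transpose_def)

lemma partial_transpose_index:
  "i < n * m \<Longrightarrow> j < n * m \<Longrightarrow>
     partial_transpose n m A $$ (i, j) = A $$ (i div m * m + j mod m, j div m * m + i mod m)"
  by (simp add: partial_transpose_def)

lemma partial_transpose_involution:
  assumes "A \<in> carrier_mat (n * m) (n * m)"
  shows "partial_transpose n m (partial_transpose n m A) = A"
proof (rule eq_matI)
  fix i j assume ij: "i < dim_row A" "j < dim_col A"
  \<comment> \<open>An index below \<open>n * m\<close> exists, so \<open>m\<close> is positive and
    div and mod recover the two components of a recombined index.\<close>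
  then have "m > 0" using assms by (cases m) auto
  with ij assms show "partial_transpose n m (partial_transpose n m A) $$ (i, j) = A $$ (i, j)"
    by (auto simp: partial_transpose_index div_mult_add_mod_less)
qed (use assms in \<open>auto simp: partial_transpose_def\<close>)

lemma partial_transpose_hermitian:
  assumes "A \<in> hermitian_ops (n * m)"
  shows "partial_transpose n m A \<in> hermitian_ops (n * m)"
  using hermitian_ops_swap[OF assms]
  by (auto simp: hermitian_ops_iff partial_transpose_carrier partial_transpose_index div_mult_add_mod_less)

lemma partial_transpose_kronecker:
  assumes "A \<in> carrier_mat n n" "B \<in> carrier_mat m m"
  shows "partial_transpose n m (kronecker A B) = kronecker A (transpose_mat B)"
proof (rule eq_matI)
  fix i j assume "i < dim_row (kronecker A (transpose_mat B))" "j < dim_col (kronecker A (transpose_mat B))"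
  then have ij: "i < n * m" "j < n * m" using assms by (auto simp: kronecker_def)
  then have "m > 0" by (cases m) auto
  with ij assms show "partial_transpose n m (kronecker A B) $$ (i, j) = kronecker A (transpose_mat B) $$ (i, j)"
    by (auto simp: partial_transpose_index kronecker_def div_mult_add_mod_less)
qed (use assms in \<open>auto simp: partial_transpose_def kronecker_def\<close>)

text \<open>The exchange \<sigma> is an involution on index pairs and commutes with swapping row and
  column, so it only permutes the terms of the double sum.\<close>

lemma mat_trace_mult_partial_transpose:
  assumes "A \<in> carrier_mat (n * m) (n * m)" "B \<in> carrier_mat (n * m) (n * m)"
  shows "mat_trace (partial_transpose n m A * partial_transpose n m B) = mat_trace (A * B)"
proof -
  define \<sigma> where "\<sigma> = (\<lambda>(i, j). (i div m * m + j mod m, j div m * m + i mod m))"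
  let ?I = "{..<n * m} \<times> {..<n * m}"
  have \<sigma>: "\<sigma> p \<in> ?I" "\<sigma> (\<sigma> p) = p" if "p \<in> ?I" for p
  proof -
    have "m > 0" using that by (cases m) auto
    with that show "\<sigma> p \<in> ?I" "\<sigma> (\<sigma> p) = p"
      by (auto simp: \<sigma>_def div_mult_add_mod_less)
  qed
  have "(\<Sum>(i, j)\<in>?I. partial_transpose n m A $$ (i, j) * partial_transpose n m B $$ (j, i)) =
    (\<Sum>(i, j)\<in>?I. A $$ (i, j) * B $$ (j, i))"
    by (rule sum.reindex_bij_witness[of _ \<sigma> \<sigma>])
      (use \<sigma> in \<open>auto simp: partial_transpose_index \<sigma>_def\<close>)
  then show ?thesis
    by (simp add: mat_trace_mult[OF assms] sum.cartesian_product
        mat_trace_mult[OF partial_transpose_carrier partial_transpose_carrier])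
qed

lemma bij_betw_partial_transpose:
  assumes "S \<subseteq> carrier_mat (n * m) (n * m)"
  shows "bij_betw (partial_transpose n m) S (partial_transpose n m ` S)"
    "bij_betw (partial_transpose n m) (partial_transpose n m ` S) S"
proof -
  have inv: "partial_transpose n m (partial_transpose n m A) = A" if "A \<in> S" for A
    using that assms by (intro partial_transpose_involution) auto
  then show "bij_betw (partial_transpose n m) S (partial_transpose n m ` S)"
    "bij_betw (partial_transpose n m) (partial_transpose n m ` S) S"
    by (auto intro!: bij_betw_byWitness[where f' = "partial_transpose n m"])
qed

text \<open>A product of \<open>X\<close> and \<open>Y\<close> is the partial transpose of the
  product of \<open>X\<close> and the transpose of \<open>Y\<close>, which is again a product from
  the same sets.\<close>

lemma product_ops_subset_partial_transpose:
  assumes "S \<subseteq> carrier_mat n n" "S' \<subseteq> carrier_mat m m" "\<And>Y. Y \<in> S' \<Longrightarrow> transpose_mat Y \<in> S'"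
    and "product_ops S S' \<subseteq> T"
  shows "product_ops S S' \<subseteq> partial_transpose n m ` T"
proof
  fix Z assume "Z \<in> product_ops S S'"
  then obtain X Y where Z: "Z = kronecker X Y" and XY: "X \<in> S" "Y \<in> S'"
    by (auto simp: product_ops_def)
  then have "Z = partial_transpose n m (kronecker X (transpose_mat Y))"
    using assms by (subst partial_transpose_kronecker) auto
  moreover have "kronecker X (transpose_mat Y) \<in> T"
    using assms(3,4) XY unfolding product_ops_def by blast
  ultimately show "Z \<in> partial_transpose n m ` T" by blast
qed

section \<open>Bounds on the probabilities, and an entangled state separating the two
  structures\<close>

lemma mat_trace_statistical_effect:
  assumes W: "W \<in> statistical_ops n" and F: "F \<in> effect_ops n"
  shows "0 \<le> mat_trace (W * F)" "mat_trace (W * F) \<le> 1"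
proof -
  have W': "W \<in> psd_ops n" "mat_trace W = 1" using W by (auto simp: statistical_ops_def)
  have F': "F \<in> psd_cone n" "1\<^sub>m n - F \<in> psd_cone n" using F by (auto simp: effect_ops_iff)
  have c: "W \<in> carrier_mat n n" "F \<in> carrier_mat n n"
    using W'(1) F'(1) psd_cone_carrier by (auto simp: psd_ops_eq_psd_cone)
  show "0 \<le> mat_trace (W * F)"
    by (rule mat_trace_mult_nonneg[OF W'(1) F'(1)])
  \<comment> \<open>The upper bound is the lower bound applied to the complementary effect.\<close>
  have "W * (1\<^sub>m n - F) = W - W * F"
    using c by (simp add: mult_minus_distrib_mat[of _ n n _ n])
  then have "mat_trace (W * (1\<^sub>m n - F)) = 1 - mat_trace (W * F)"
    using c W'(2) by (simp add: mat_trace_minus[of _ n])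
  with mat_trace_mult_nonneg[OF W'(1) F'(2)] show "mat_trace (W * F) \<le> 1" by simp
qed

text \<open>Positions 0 and 3 number the basis vectors 00 and 11, so this is the projector onto the
  Bell vector (|00> + |11>)/sqrt 2.\<close>

definition max_entangled :: "complex mat" where
  "max_entangled = (1/2) \<cdot>\<^sub>m outer_prod (vec 4 (\<lambda>i. if i = 0 \<or> i = 3 then 1 else 0))"

lemma sum_lessThan_4: "(\<Sum>i<4. f i) = f 0 + f 1 + f 2 + f (3 :: nat)"
  for f :: "nat \<Rightarrow> 'a :: comm_monoid_add"
  by (simp add: numeral_eq_Suc)

lemma max_entangled_statistical: "max_entangled \<in> statistical_ops 4"
proof -
  let ?v = "vec 4 (\<lambda>i. if i = 0 \<or> i = 3 then 1 else 0) :: complex vec"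
  have half: "complex_of_real (sqrt (1/2)) * cnj (complex_of_real (sqrt (1/2))) = 1/2"
    unfolding complex_cnj_complex_of_real of_real_mult[symmetric] by simp
  have "outer_prod (complex_of_real (sqrt (1/2)) \<cdot>\<^sub>v ?v) = max_entangled"
    unfolding outer_prod_smult max_entangled_def half ..
  moreover have "outer_prod (complex_of_real (sqrt (1/2)) \<cdot>\<^sub>v ?v) \<in> psd_cone 4"
    by (rule outer_prod_psd_cone) simp
  moreover have "mat_trace max_entangled = 1"
    by (simp add: mat_trace_def max_entangled_def outer_prod_def sum_lessThan_4)
  ultimately show ?thesis
    by (simp add: statistical_ops_def psd_ops_eq_psd_cone)
qed

text \<open>The witness \<open>(0, 1, -1, 0)\<close> is the singlet vector, an eigenvector of the partial transpose for
  the eigenvalue \<open>-1/2\<close>.\<close>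

lemma partial_transpose_max_entangled: "partial_transpose 2 2 max_entangled \<notin> statistical_ops 4"
proof
  assume "partial_transpose 2 2 max_entangled \<in> statistical_ops 4"
  then have psd: "partial_transpose 2 2 max_entangled \<in> psd_ops 4"
    by (simp add: statistical_ops_def)
  define v :: "complex vec" where "v = vec 4 (\<lambda>i. if i = 1 then 1 else if i = 2 then - 1 else 0)"
  have v: "v \<in> carrier_vec 4" by (simp add: v_def)
  have c: "partial_transpose 2 2 max_entangled \<in> carrier_mat 4 4"
    using partial_transpose_carrier[of 2 2 max_entangled] by simp
  have "(partial_transpose 2 2 max_entangled *\<^sub>v v) \<bullet>c v = -1"
    unfolding cscalar_prod_mult_mat_vec[OF c v v]
    by (simp add: partial_transpose_def max_entangled_def outer_prod_def v_def sum_lessThan_4)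
  with psd v show False by (auto simp: psd_ops_def less_eq_complex_def)
qed

theorem proposition2:
  shows "\<exists>(K :: complex mat set) (L :: complex mat set) \<mu>
            (K' :: complex mat set) (L' :: complex mat set) \<mu>'.
     statistical_structure (K, L, \<mu>) \<and> statistical_structure (K', L', \<mu>') \<and>
     (K, L, \<mu>) \<noteq> (K', L', \<mu>') \<and>
     isomorphic_structures (K, L, \<mu>) (K', L', \<mu>') \<and>
     realizable (K, L, \<mu>) \<and> realizable (K', L', \<mu>') \<and>
     product_ops (statistical_ops 2) (statistical_ops 2) \<subseteq> K \<and> K \<subseteq> hermitian_ops (2 * 2) \<and>
     product_ops (statistical_ops 2) (statistical_ops 2) \<subseteq> K' \<and> K' \<subseteq> hermitian_ops (2 * 2) \<and>
     product_ops (effect_ops 2) (effect_ops 2) \<subseteq> L \<and> L \<subseteq> hermitian_ops (2 * 2) \<and>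
     product_ops (effect_ops 2) (effect_ops 2) \<subseteq> L' \<and> L' \<subseteq> hermitian_ops (2 * 2) \<and>
     (\<forall>W\<in>K. \<forall>F\<in>L. complex_of_real (\<mu> (W, F)) = mat_trace (W * F)) \<and>
     (\<forall>W\<in>K'. \<forall>F\<in>L'. complex_of_real (\<mu>' (W, F)) = mat_trace (W * F))"
proof -
  define T where "T = (partial_transpose 2 2 :: complex mat \<Rightarrow> complex mat)"
  define K where "K = statistical_ops (2 * 2)"
  define L where "L = effect_ops (2 * 2)"
  \<comment> \<open>\<open>mat_trace\<close> is complex-valued; the real part loses nothing because
    the bounds below make the trace real. The restriction provides the required
    extensionality.\<close>
  define \<mu> where "\<mu> = restrict (\<lambda>(W, F). Re (mat_trace (W * F))) (K \<times> L)"
  define \<mu>' where "\<mu>' = restrict (\<lambda>(W, F). Re (mat_trace (W * F))) (T ` K \<times> T ` L)"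
  have KH: "K \<subseteq> hermitian_ops (2 * 2)" and LH: "L \<subseteq> hermitian_ops (2 * 2)"
    by (auto simp: K_def L_def statistical_ops_def psd_ops_def effect_ops_def)
  have Kc: "K \<subseteq> carrier_mat (2 * 2) (2 * 2)" and Lc: "L \<subseteq> carrier_mat (2 * 2) (2 * 2)"
    using KH LH hermitian_ops_carrier by blast+
  have TH: "T ` K \<subseteq> hermitian_ops (2 * 2)" "T ` L \<subseteq> hermitian_ops (2 * 2)"
    using KH LH partial_transpose_hermitian unfolding T_def by blast+
  have tr_T: "mat_trace (T W * T F) = mat_trace (W * F)" if "W \<in> K" "F \<in> L" for W F
    unfolding T_def using that Kc Lc by (intro mat_trace_mult_partial_transpose) auto
  have TT: "T (T W) = W" if "W \<in> K \<union> L" for W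
    unfolding T_def using that Kc Lc by (intro partial_transpose_involution) auto
  note bij = bij_betw_partial_transpose[OF Kc, folded T_def] bij_betw_partial_transpose[OF Lc, folded T_def]
  have bounds: "0 \<le> mat_trace (W * F)" "mat_trace (W * F) \<le> 1" if "W \<in> K" "F \<in> L" for W F
    using that mat_trace_statistical_effect unfolding K_def L_def by blast+
  have \<mu>: "complex_of_real (\<mu> (W, F)) = mat_trace (W * F)" if "W \<in> K" "F \<in> L" for W F
    using that bounds(1)[OF that] by (simp add: \<mu>_def less_eq_complex_def complex_eq_iff)
  have \<mu>': "complex_of_real (\<mu>' (T W, T F)) = mat_trace (T W * T F)" if "W \<in> K" "F \<in> L" for W F
    using that bounds(1)[OF that] by (simp add: \<mu>'_def tr_T less_eq_complex_def complex_eq_iff)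
  have iso: "\<mu>' (T W, T F) = \<mu> (W, F)" if "W \<in> K" "F \<in> L" for W F
    using that by (simp add: \<mu>_def \<mu>'_def tr_T)
  have \<mu>_range: "\<mu> (W, F) \<in> {0..1}" if "W \<in> K" "F \<in> L" for W F
    using that bounds[OF that] by (simp add: \<mu>_def less_eq_complex_def)
  have struct: "statistical_structure (K, L, \<mu>)"
    using \<mu>_range by (auto simp: PiE_iff) (auto simp: \<mu>_def)
  have struct': "statistical_structure (T ` K, T ` L, \<mu>')"
    using \<mu>_range iso by (auto simp: PiE_iff) (auto simp: \<mu>'_def)
  \<comment> \<open>The triples already differ in their sets of states.\<close>
  have "T max_entangled \<in> T ` K" "T max_entangled \<notin> K"
    using max_entangled_statistical partial_transpose_max_entangled by (auto simp: T_def K_def)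
  then have neq: "(K, L, \<mu>) \<noteq> (T ` K, T ` L, \<mu>')" by blast
  have isom: "isomorphic_structures (K, L, \<mu>) (T ` K, T ` L, \<mu>')"
    unfolding isomorphic_structures.simps using bij(1,3) iso by blast
  have real: "realizable (K, L, \<mu>)"
    unfolding realizable.simps using \<mu> bij_betw_id[of K] bij_betw_id[of L]
    by (intro exI[of _ "2 * 2"] exI[of _ id]) (simp add: K_def L_def)
  \<comment> \<open>\<open>T\<close> itself serves as both bijections: it carries the images back to
    \<open>K\<close> and \<open>L\<close> and preserves the trace pairing.\<close>
  have real': "realizable (T ` K, T ` L, \<mu>')"
    unfolding realizable.simps
    using bij(2,4) \<mu>' tr_T TT by (intro exI[of _ "2 * 2"] exI[of _ T]) (auto simp: K_def L_def)
  have sub: "statistical_ops 2 \<subseteq> carrier_mat 2 2" "effect_ops 2 \<subseteq> carrier_mat 2 2"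
    by (auto simp: statistical_ops_def psd_ops_def effect_ops_def hermitian_ops_def)
  have prod: "product_ops (statistical_ops 2) (statistical_ops 2) \<subseteq> K"
    "product_ops (effect_ops 2) (effect_ops 2) \<subseteq> L"
    unfolding K_def L_def by (rule product_ops_statistical_ops product_ops_effect_ops)+
  have prod': "product_ops (statistical_ops 2) (statistical_ops 2) \<subseteq> T ` K"
    "product_ops (effect_ops 2) (effect_ops 2) \<subseteq> T ` L"
    unfolding T_def using sub prod transpose_statistical_ops transpose_effect_ops
    by (intro product_ops_subset_partial_transpose; blast)+
  show ?thesis
    by (intro exI[of _ K] exI[of _ L] exI[of _ \<mu>] exI[of _ "T ` K"] exI[of _ "T ` L"] exI[of _ \<mu>'] conjI
        struct struct' neq isom real real' prod prod' KH LH TH) (use \<mu> \<mu>' in auto)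
qed

end
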